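(* There is a constant $\kappa > 0$ such that for all integers $n \geq 1$ and $d \geq 2$, every formula computing $\mathrm{OV}_{n,d}$ whose gates compute arbitrary symmetric Boolean functions of unbounded fan-in has at least $$\kappa\cdot\min\left\{\frac{n^2}{\log d},\ \frac{n\cdot 2^d}{d^{1/2}\log d}\right\}$$ wires.
   Context: The Orthogonal Vectors function $\mathrm{OV}_{n,d}:\{0,1\}^{nd}\to\{0,1\}$ takes $n$ vectors $v_1,\ldots,v_n \in \{0,1\}^d$ and outputs $1$ iff there exist $i,j$ with $\langle v_i,v_j\rangle = 0$. A symmetric-gate formula is a rooted tree whose leaves are labeled by input variables and whose internal nodes are gates of arbitrary (unbounded) fan-in, each computing some symmetric Boolean function of its inputs (a function depending only on the number of ones among its inputs). The number of wires is the number of edges of the tree. *)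

theory Defs
  imports Complex_Main
begin

text \<open>
  Boolean functions of arity \<open>k\<close> are predicates on lists, of which only the values
  on lists of length \<open>k\<close> matter.
\<close>

definition symmetric_function :: "nat \<Rightarrow> (bool list \<Rightarrow> bool) \<Rightarrow> bool" where
  "symmetric_function k g \<longleftrightarrow>
     (\<forall>xs ys. length xs = k \<and> length ys = k \<and> count_list xs True = count_list ys True
        \<longrightarrow> g xs = g ys)"

datatype 'v formula =
    Leaf 'v
  | Gate "bool list \<Rightarrow> bool" "'v formula list"

text \<open>A node without children is a leaf, so the fan-in of a gate is at least 1.\<close>

primrec symmetric_gate_formula :: "'v formula \<Rightarrow> bool" where
  "symmetric_gate_formula (Leaf v) \<longleftrightarrow> True"
| "symmetric_gate_formula (Gate g fs) \<longleftrightarrow>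
     fs \<noteq> [] \<and> symmetric_function (length fs) g \<and> list_all (\<lambda>b. b) (map symmetric_gate_formula fs)"

primrec eval_formula :: "('v \<Rightarrow> bool) \<Rightarrow> 'v formula \<Rightarrow> bool" where
  "eval_formula x (Leaf v) = x v"
| "eval_formula x (Gate g fs) = g (map (eval_formula x) fs)"

primrec wires :: "'v formula \<Rightarrow> nat" where
  "wires (Leaf v) = 0"
| "wires (Gate g fs) = length fs + sum_list (map wires fs)"

text \<open>
  The input variables of \<open>OV n d\<close> are the pairs \<open>(i, k)\<close> with \<open>i < n\<close> and \<open>k < d\<close>;
  the variable \<open>(i, k)\<close> is the \<open>k\<close>-th coordinate of the \<open>i\<close>-th vector. An assignment is
  a total function whose values at other pairs are irrelevant.
  The indices of an orthogonal pair may coincide. For \<open>n \<ge> 2\<close> this makes no difference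
  (a vector orthogonal to itself is zero, hence orthogonal to all others); for \<open>n = 1\<close>
  the function would otherwise be constant.
\<close>

definition OV_vars :: "nat \<Rightarrow> nat \<Rightarrow> (nat \<times> nat) set" where
  "OV_vars n d = {..<n} \<times> {..<d}"

definition OV :: "nat \<Rightarrow> nat \<Rightarrow> (nat \<times> nat \<Rightarrow> bool) \<Rightarrow> bool" where
  "OV n d x \<longleftrightarrow>
     (\<exists>i<n. \<exists>j<n. (\<Sum>k<d. of_bool (x (i, k)) * of_bool (x (j, k)) :: nat) = 0)"

definition computes_OV :: "nat \<Rightarrow> nat \<Rightarrow> (nat \<times> nat) formula \<Rightarrow> bool" where
  "computes_OV n d F \<longleftrightarrow>
     set_formula F \<subseteq> OV_vars n d \<and> (\<forall>x. eval_formula x F = OV n d x)"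

end

theory Submission
  imports Defs "HOL-Library.Disjoint_Sets"
begin

text \<open>
  The argument is Neciporuk's method. Fixing the variables outside a block \<open>B\<close> turns a
  symmetric gate with \<open>t\<close> children that still depend on \<open>B\<close> into one of at most \<open>2 ^ (t + 1)\<close>
  symmetric functions of these children, whatever its fan-in was. Hence a formula with \<open>s\<close>
  leaves in \<open>B\<close> has only \<open>2 ^ O(s)\<close> subfunctions on \<open>B\<close>. On the other hand, let \<open>B\<close> be the block
  of coordinates of one vector, and choose the other vectors among those of the form
  \<open>{0} \<union> X\<close> with \<open>X\<close> in the middle layer of the remaining \<open>d - 1\<close> coordinates. These intersect
  pairwise and form an antichain, so the complement of each of them detects whether it was
  chosen, and there are at least \<open>2 ^ min (n - 1) (d - 1 choose (d - 1) div 2)\<close> subfunctions.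
\<close>

section \<open>Counting subfunctions of symmetric-gate formulas\<close>

primrec leaves_in :: "'v set \<Rightarrow> 'v formula \<Rightarrow> nat" where
  "leaves_in B (Leaf v) = of_bool (v \<in> B)"
| "leaves_in B (Gate g fs) = sum_list (map (leaves_in B) fs)"

text \<open>
  Closing the set under unary functions \<open>h\<close> makes gates with a single nonconstant child,
  which may form arbitrarily long chains, contribute nothing to the count.
\<close>
definition subfunctions :: "'v set \<Rightarrow> 'v formula \<Rightarrow> (('v \<Rightarrow> bool) \<Rightarrow> bool) set" where
  "subfunctions B F = {\<lambda>z. h (eval_formula (override_on y z B) F) | h y. True}"

lemma subfunctionsI: "(\<lambda>z. h (eval_formula (override_on y z B) F)) \<in> subfunctions B F"
  unfolding subfunctions_def by blast

lemma eval_formula_leaves_in_0: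
  "leaves_in B F = 0 \<Longrightarrow> eval_formula (override_on y z B) F = eval_formula y F"
proof (induction F)
  case (Gate g fs)
  then have "map (eval_formula (override_on y z B)) fs = map (eval_formula y) fs"
    by auto
  then show ?case unfolding eval_formula.simps by (rule arg_cong)
qed auto

lemma subfunctions_leaves_in_0:
  assumes "leaves_in B F = 0" "f \<in> subfunctions B F"
  shows "f z = f z'"
  using assms by (auto simp: subfunctions_def eval_formula_leaves_in_0)

lemma symmetric_gate_count:
  assumes "symmetric_function k g"
  obtains h where "\<And>xs. length xs = k \<Longrightarrow> g xs = h (count_list xs True)"
proof
  let ?h = "\<lambda>c. \<exists>ys. length ys = k \<and> count_list ys True = c \<and> g ys"
  fix xs :: "bool list"
  assume "length xs = k"
  then show "g xs = ?h (count_list xs True)"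
    using assms unfolding symmetric_function_def by blast
qed

lemma count_list_map_filter:
  "count_list (map p xs) a =
     count_list (map p (filter Q xs)) a + count_list (map p (filter (\<lambda>x. \<not> Q x) xs)) a"
  by (induction xs) auto

lemma finite_listset: "(\<And>A. A \<in> set As \<Longrightarrow> finite A) \<Longrightarrow> finite (listset As)"
  by (induction As) (auto simp: set_Cons_def intro!: finite_image_set2)

lemma card_listset_le:
  assumes "\<And>A. A \<in> set As \<Longrightarrow> finite A"
  shows "card (listset As) \<le> prod_list (map card As)"
  using assms
proof (induction As)
  case (Cons A As)
  have eq: "listset (A # As) = (\<lambda>(x, xs). x # xs) ` (A \<times> listset As)"
    by (auto simp: set_Cons_def)
  have "card (listset (A # As)) \<le> card (A \<times> listset As)"
    unfolding eq using Cons.prems finite_listset[of As] by (intro card_image_le) auto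
  also have "\<dots> \<le> card A * prod_list (map card As)"
    using Cons by (simp add: card_cartesian_product)
  finally show ?case by simp
qed simp

lemma listset_map: "(\<And>x. x \<in> set xs \<Longrightarrow> p x \<in> S x) \<Longrightarrow> map p xs \<in> listset (map S xs)"
  by (induction xs) (auto simp: set_Cons_def)

text \<open>Children without leaves in \<open>B\<close> are constant once the outside variables are
  fixed. Together they add a fixed number of ones, and this shift is absorbed into \<open>h\<close>,
  so the full fan-in disappears from the count.\<close>

lemma subfunctions_Gate:
  assumes "symmetric_function (length fs) g" "f \<in> subfunctions B (Gate g fs)"
  defines "gs \<equiv> filter (\<lambda>F. leaves_in B F \<noteq> 0) fs"
  obtains h y where
    "f = (\<lambda>z. h (count_list (map (eval_formula (override_on y z B)) gs) True))"
proof -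
  obtain h y where f: "f = (\<lambda>z. h (eval_formula (override_on y z B) (Gate g fs)))"
    using assms(2) unfolding subfunctions_def by blast
  obtain h' where h': "\<And>xs. length xs = length fs \<Longrightarrow> g xs = h' (count_list xs True)"
    using symmetric_gate_count[OF assms(1)] by blast
  define c where "c = count_list (map (eval_formula y) (filter (\<lambda>F. leaves_in B F = 0) fs)) True"
  have "f z = h (h' (count_list (map (eval_formula (override_on y z B)) gs) True + c))" for z
  proof -
    let ?e = "eval_formula (override_on y z B)"
    have const: "map ?e (filter (\<lambda>F. leaves_in B F = 0) fs)
        = map (eval_formula y) (filter (\<lambda>F. leaves_in B F = 0) fs)"
      by (auto simp: eval_formula_leaves_in_0)
    have "count_list (map ?e fs) True = count_list (map ?e gs) True + c"
      unfolding gs_def c_def const[symmetric]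
      by (subst count_list_map_filter[of _ _ _ "\<lambda>F. leaves_in B F \<noteq> 0"]) (simp only: not_not)
    then show ?thesis by (simp add: f h')
  qed
  then show thesis
    by (intro that[of "\<lambda>b. h (h' (b + c))" y]) auto
qed

lemma sum_list_filter_nonzero:
  "sum_list (map p (filter (\<lambda>x. p x \<noteq> 0) xs)) = (sum_list (map p xs) :: nat)"
  by (induction xs) auto

text \<open>Each child brings a slack of 3 in the exponent; over \<open>t\<close> children the total
  \<open>3 * t\<close> pays for the choice of the gate function. The first claim ensures that the
  subtraction in the second is not truncated.\<close>

lemma prod_list_power_le:
  fixes p c :: "'a \<Rightarrow> nat"
  assumes "\<And>x. x \<in> set xs \<Longrightarrow> p x \<noteq> 0 \<and> c x \<le> 2 ^ (5 * p x - 3)"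
  shows "3 * length xs \<le> 5 * sum_list (map p xs)"
    and "prod_list (map c xs) \<le> 2 ^ (5 * sum_list (map p xs) - 3 * length xs)"
proof -
  have "3 * length xs \<le> 5 * sum_list (map p xs) \<and>
        prod_list (map c xs) \<le> 2 ^ (5 * sum_list (map p xs) - 3 * length xs)"
    using assms
  proof (induction xs)
    case (Cons x xs)
    let ?s = "5 * sum_list (map p xs)" and ?l = "3 * length xs"
    have IH: "?l \<le> ?s" "prod_list (map c xs) \<le> 2 ^ (?s - ?l)"
      using Cons by auto
    have x: "p x \<noteq> 0" "c x \<le> 2 ^ (5 * p x - 3)"
      using Cons.prems by auto
    have "c x * prod_list (map c xs) \<le> 2 ^ (5 * p x - 3) * 2 ^ (?s - ?l)"
      using x IH by (intro mult_mono) auto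
    also have "\<dots> = 2 ^ ((5 * p x - 3) + (?s - ?l))"
      by (simp add: power_add)
    also have "(5 * p x - 3) + (?s - ?l) = 5 * sum_list (map p (x # xs)) - 3 * length (x # xs)"
      using x IH by simp
    finally show ?case using IH x by simp
  qed simp
  then show "3 * length xs \<le> 5 * sum_list (map p xs)"
    "prod_list (map c xs) \<le> 2 ^ (5 * sum_list (map p xs) - 3 * length xs)" by auto
qed

text \<open>The \<open>- 3\<close> strengthens the induction hypothesis so that branching gates can
  be paid for. With no leaf in \<open>B\<close> the bound would read \<open>2 ^ 0\<close>, although
  both constant functions occur.\<close>

lemma card_subfunctions_le:
  assumes "symmetric_gate_formula F" "leaves_in B F \<noteq> 0"
  shows "finite (subfunctions B F) \<and> card (subfunctions B F) \<le> 2 ^ (5 * leaves_in B F - 3)"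
  using assms
proof (induction F)
  case (Leaf v)
  then have v: "v \<in> B" by (auto split: if_splits)
  \<comment> \<open>The four functions of the single bit \<open>z v\<close>, which match
    \<open>2 ^ (5 * 1 - 3)\<close>; each \<open>h\<close> is given by the set \<open>A\<close> where
    it is true.\<close>
  let ?U = "(\<lambda>A z. z v \<in> A) ` Pow (UNIV :: bool set)"
  have "subfunctions B (Leaf v) \<subseteq> ?U"
  proof
    fix f assume "f \<in> subfunctions B (Leaf v)"
    then obtain h where "f = (\<lambda>z. h (z v))"
      using v unfolding subfunctions_def by auto
    then have "f = (\<lambda>z. z v \<in> Collect h)" by simp
    then show "f \<in> ?U" by blast
  qed
  moreover have "card (Pow (UNIV :: bool set)) = 4"
    by (subst card_Pow) simp_all
  then have "card ?U \<le> 4"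
    using card_image_le[of "Pow (UNIV :: bool set)" "\<lambda>A z. z v \<in> A"] by simp
  ultimately show ?case
    using v card_mono[of ?U "subfunctions B (Leaf v)"] finite_subset[of _ ?U] by fastforce
next
  case (Gate g fs)
  define gs where "gs = filter (\<lambda>F. leaves_in B F \<noteq> 0) fs"
  have sym: "symmetric_function (length fs) g"
    and child: "\<And>F. F \<in> set gs \<Longrightarrow> leaves_in B F \<noteq> 0 \<and> finite (subfunctions B F) \<and>
        card (subfunctions B F) \<le> 2 ^ (5 * leaves_in B F - 3)"
    using Gate by (auto simp: gs_def list_all_iff)
  have leaves: "leaves_in B (Gate g fs) = sum_list (map (leaves_in B) gs)"
    by (simp only: leaves_in.simps gs_def sum_list_filter_nonzero)
  show ?case
  proof (cases "\<exists>F. gs = [F]")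
    case True
    then obtain F where F: "gs = [F]" by blast
    \<comment> \<open>A lone nonconstant child yields a count of 0 or 1, so the gate acts on it as a
      unary function, already covered by the closure under \<open>h\<close>.\<close>
    have "subfunctions B (Gate g fs) \<subseteq> subfunctions B F"
    proof
      fix f assume "f \<in> subfunctions B (Gate g fs)"
      then obtain h y where
        f: "f = (\<lambda>z. h (count_list (map (eval_formula (override_on y z B)) gs) True))"
        using subfunctions_Gate[OF sym] unfolding gs_def by blast
      have "f = (\<lambda>z. h (of_bool (eval_formula (override_on y z B) F)))"
        by (simp add: f F of_bool_def)
      then show "f \<in> subfunctions B F"
        using subfunctionsI[of "\<lambda>b. h (of_bool b)" y B F] by (simp only:)
    qed
    moreover have "finite (subfunctions B F)" "card (subfunctions B F) \<le> 2 ^ (5 * leaves_in B F - 3)"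
      using child F by auto
    ultimately show ?thesis
      using card_mono[of "subfunctions B F" "subfunctions B (Gate g fs)"] finite_subset
      unfolding leaves F by fastforce
  next
    case False
    let ?t = "length gs"
    have "gs \<noteq> []" using Gate.prems(2) leaves by auto
    with False have t: "?t \<ge> 2" by (cases gs; cases "tl gs") auto
    \<comment> \<open>A subfunction of the gate is fixed by the set of accepted counts among
      \<open>0, ..., ?t\<close>, giving the factor \<open>2 ^ (?t + 1)\<close>, and one subfunction
      per child.\<close>
    let ?D = "Pow {..?t} \<times> listset (map (subfunctions B) gs)"
    let ?\<Phi> = "\<lambda>(A, \<phi>s) z. count_list (map (\<lambda>\<phi>. \<phi> z) \<phi>s) True \<in> A"
    have sub: "subfunctions B (Gate g fs) \<subseteq> ?\<Phi> ` ?D"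
    proof
      fix f assume "f \<in> subfunctions B (Gate g fs)"
      then obtain h y where
        f: "f = (\<lambda>z. h (count_list (map (eval_formula (override_on y z B)) gs) True))"
        using subfunctions_Gate[OF sym] unfolding gs_def by blast
      let ?\<phi>s = "map (\<lambda>F z. eval_formula (override_on y z B) F) gs"
      let ?A = "{c. c \<le> ?t \<and> h c}"
      have "?\<phi>s \<in> listset (map (subfunctions B) gs)"
        by (intro listset_map) (use subfunctionsI[of "\<lambda>b. b"] in auto)
      then have "(?A, ?\<phi>s) \<in> ?D" by auto
      moreover have "count_list (map (eval_formula (override_on y z B)) gs) True \<le> ?t" for z
        using count_le_length[of "map (eval_formula (override_on y z B)) gs" True] by simp
      then have "f = ?\<Phi> (?A, ?\<phi>s)"
        by (simp add: f comp_def)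
      ultimately show "f \<in> ?\<Phi> ` ?D" by blast
    qed
    have finL: "finite (listset (map (subfunctions B) gs))"
      using child by (intro finite_listset) auto
    then have finD: "finite ?D" by simp
    have pw: "3 * ?t \<le> 5 * sum_list (map (leaves_in B) gs)"
      "prod_list (map (\<lambda>F. card (subfunctions B F)) gs)
         \<le> 2 ^ (5 * sum_list (map (leaves_in B) gs) - 3 * ?t)"
      using prod_list_power_le[of gs "leaves_in B" "\<lambda>F. card (subfunctions B F)"] child by auto
    have "card (?\<Phi> ` ?D) \<le> card ?D"
      by (rule card_image_le[OF finD])
    also have "\<dots> = 2 ^ (?t + 1) * card (listset (map (subfunctions B) gs))"
      by (simp add: card_cartesian_product card_Pow)
    also have "\<dots> \<le> 2 ^ (?t + 1) * prod_list (map (\<lambda>F. card (subfunctions B F)) gs)"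
      using card_listset_le[of "map (subfunctions B) gs"] child by (auto simp: comp_def)
    also have "\<dots> \<le> 2 ^ (?t + 1) * 2 ^ (5 * sum_list (map (leaves_in B) gs) - 3 * ?t)"
      using pw by (intro mult_left_mono) auto
    also have "\<dots> = 2 ^ ((?t + 1) + (5 * sum_list (map (leaves_in B) gs) - 3 * ?t))"
      by (simp add: power_add)
    \<comment> \<open>Here \<open>3 * ?t - (?t + 1) \<ge> 3\<close>, which holds exactly because
      \<open>?t \<ge> 2\<close>.\<close>
    also have "\<dots> \<le> 2 ^ (5 * sum_list (map (leaves_in B) gs) - 3)"
      using t pw by (intro power_increasing) auto
    finally have "card (?\<Phi> ` ?D) \<le> 2 ^ (5 * leaves_in B (Gate g fs) - 3)"
      unfolding leaves .
    then show ?thesis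
      using sub finD card_mono[OF _ sub] finite_subset[OF sub] by fastforce
  qed
qed

text \<open>Every node except the root has its own edge to its parent, so there are at most
  \<open>Suc (wires F)\<close> leaves, and disjoint blocks count each at most once.\<close>

lemma sum_leaves_in_le:
  fixes F :: "'v formula" and B :: "'i \<Rightarrow> 'v set"
  assumes "finite I" "disjoint_family_on B I"
  shows "(\<Sum>i\<in>I. leaves_in (B i) F) \<le> Suc (wires F)"
proof (induction F)
  case (Leaf v)
  have "card {i \<in> I. v \<in> B i} \<le> 1"
    using assms by (auto simp: disjoint_family_on_def card_le_Suc0_iff_eq)
  then show ?case using assms(1) by (simp add: Int_def)
next
  case (Gate g fs)
  have "(\<Sum>i\<in>I. leaves_in (B i) (Gate g fs)) = (\<Sum>F\<leftarrow>fs. \<Sum>i\<in>I. leaves_in (B i) F)"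
    by (induction fs) (simp_all add: sum.distrib)
  also have "\<dots> \<le> (\<Sum>F\<leftarrow>fs. Suc (wires F))"
    using Gate by (intro sum_list_mono) auto
  also have "\<dots> = length fs + (\<Sum>F\<leftarrow>fs. wires F)"
    by (induction fs) auto
  finally show ?case by simp
qed

section \<open>Subfunctions of orthogonal vectors\<close>

lemma OV_iff: "OV n d x \<longleftrightarrow> (\<exists>i<n. \<exists>j<n. \<forall>k<d. \<not> (x (i, k) \<and> x (j, k)))"
  unfolding OV_def by auto

text \<open>Fixing the other rows according to a subset \<open>S\<close> of \<open>m\<close> row
  indices gives \<open>2 ^ m\<close> distinct subfunctions on row \<open>i\<close>. The cap
  \<open>n - 1\<close> counts the other rows, the binomial coefficient the available sets
  \<open>e j\<close>.\<close>

lemma leaves_in_block_ge: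
  assumes F: "symmetric_gate_formula F" "computes_OV n d F"
    and d: "d \<ge> 2" and n: "n \<ge> 2" and i: "i < n"
  defines "m \<equiv> min (n - 1) ((d - 1) choose ((d - 1) div 2))"
  shows "m \<le> 5 * leaves_in ({i} \<times> UNIV) F"
proof -
  let ?B = "{i} \<times> UNIV :: (nat \<times> nat) set"
  define M where "M = {X. X \<subseteq> {1..<d} \<and> card X = (d - 1) div 2}"
  have M: "finite M" "card M = (d - 1) choose ((d - 1) div 2)"
    unfolding M_def using n_subsets[of "{1..<d}"] by (auto intro: finite_subset[of _ "Pow {1..<d}"])
  have "m \<le> card ({..<n} - {i})" using i by (simp add: m_def)
  then obtain J where J: "J \<subseteq> {..<n} - {i}" "card J = m" "finite J"
    using obtain_subset_with_card_n by metis
  have "card J \<le> card M" by (simp add: J M m_def)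
  then obtain e where e: "e ` J \<subseteq> M" "inj_on e J"
    using card_le_inj[OF J(3) M(1)] by blast
  have mpos: "m \<ge> 1" using n d by (simp add: m_def Suc_le_eq)
  \<comment> \<open>Row \<open>j\<close> is the indicator of \<open>{0} \<union> e j\<close> if
    \<open>j\<close> is in \<open>S\<close>, and all ones otherwise. The test vector
    \<open>w j\<close> is the complement of \<open>{0} \<union> e j\<close>, placed in row
    \<open>i\<close>.\<close>
  define y where "y S = (\<lambda>(j, k). j \<in> S \<longrightarrow> k = 0 \<or> k \<in> e j)" for S
  define w where "w j = (\<lambda>(i :: nat, k). k \<noteq> 0 \<and> k \<notin> e j)" for j
  define \<phi> where "\<phi> S = (\<lambda>z. eval_formula (override_on (y S) z ?B) F)" for S
  have \<phi>_eq: "\<phi> S z = OV n d (override_on (y S) z ?B)" for S z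
    using F(2) by (simp add: \<phi>_def computes_OV_def)
  have detect: "\<phi> S (w j) \<longleftrightarrow> j \<in> S" if S: "S \<subseteq> J" and j: "j \<in> J" for S j
  proof -
    let ?x = "override_on (y S) (w j) ?B"
    have xi: "?x (i, k) \<longleftrightarrow> k \<noteq> 0 \<and> k \<notin> e j" for k
      by (simp add: override_on_def w_def)
    have xa: "?x (a, k) \<longleftrightarrow> (a \<in> S \<longrightarrow> k = 0 \<or> k \<in> e a)" if "a \<noteq> i" for a k
      using that by (simp add: override_on_def y_def)
    have eM: "e a \<subseteq> {1..<d}" "card (e a) = (d - 1) div 2" if "a \<in> J" for a
      using e that unfolding M_def by auto
    have "\<exists>k<d. k \<noteq> 0 \<and> k \<notin> e j"
    proof (rule ccontr)
      assume "\<not> ?thesis"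
      then have "{1..<d} \<subseteq> e j" by auto
      then have "e j = {1..<d}" using eM[OF j] by auto
      then have "d - 1 = (d - 1) div 2" using eM[OF j] by simp
      then show False using d by simp
    qed
    then obtain k0 where k0: "k0 < d" "k0 \<noteq> 0" "k0 \<notin> e j" by blast
    \<comment> \<open>Distinct sets of equal size are incomparable, so \<open>e a\<close> leaves
      \<open>e j\<close>. For an all-ones row, \<open>k0\<close> serves.\<close>
    have nonorth: "\<exists>k<d. k \<noteq> 0 \<and> k \<notin> e j \<and> (a \<in> S \<longrightarrow> k \<in> e a)" if a: "a \<noteq> j" for a
    proof (cases "a \<in> S")
      case True
      then have aJ: "a \<in> J" using S by blast
      have "\<not> e a \<subseteq> e j"
      proof
        assume "e a \<subseteq> e j"
        moreover have "finite (e j)" using eM[OF j] finite_subset by blast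
        ultimately have "e a = e j"
          using eM[OF j] eM[OF aJ] by (intro card_subset_eq) auto
        then show False using e(2) a aJ j by (auto dest: inj_onD)
      qed
      then obtain k where "k \<in> e a" "k \<notin> e j" by blast
      then show ?thesis using eM[OF aJ] by force
    qed (use k0 in blast)
    have ij: "j \<noteq> i" "j < n" using j J by auto
    show ?thesis
    proof
      assume "j \<in> S"
      then have "\<forall>k<d. \<not> (?x (i, k) \<and> ?x (j, k))"
        using xi xa[OF ij(1)] by auto
      then show "\<phi> S (w j)" unfolding \<phi>_eq OV_iff using ij i by blast
    next
      assume "\<phi> S (w j)"
      then obtain a b where ab: "\<And>k. k < d \<Longrightarrow> \<not> (?x (a, k) \<and> ?x (b, k))"
        unfolding \<phi>_eq OV_iff by blast
      show "j \<in> S"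
      proof (rule ccontr)
        assume jS: "j \<notin> S"
        have meet: "\<exists>k<d. ?x (i, k) \<and> ?x (a, k)" if "a \<noteq> i" for a
          using nonorth[of a] k0 jS xi xa[OF that] by (cases "a = j") auto
        consider "a = i" "b = i" | "a = i" "b \<noteq> i" | "a \<noteq> i" "b = i" | "a \<noteq> i" "b \<noteq> i"
          by blast
        then show False
        proof cases
          case 1
          then show False using ab[OF k0(1)] k0 xi by simp
        next
          case 2
          then show False using ab meet[of b] by blast
        next
          case 3
          then show False using ab meet[of a] by blast
        next
          case 4
          \<comment> \<open>Coordinate 0 is set in every row other than \<open>i\<close>, so no two
            of these are orthogonal.\<close>
          then show False using ab[of 0] d xa by simp
        qed
      qed
    qed
  qed
  have inj: "inj_on \<phi> (Pow J)"
  proof (rule inj_onI)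
    fix S T assume ST: "S \<in> Pow J" "T \<in> Pow J" "\<phi> S = \<phi> T"
    then have "j \<in> S \<longleftrightarrow> j \<in> T" if "j \<in> J" for j
      using detect[of S j] detect[of T j] that by simp
    then show "S = T" using ST(1,2) by blast
  qed
  have sub: "\<phi> ` Pow J \<subseteq> subfunctions ?B F"
    using subfunctionsI[of "\<lambda>b. b" _ ?B F] by (auto simp: \<phi>_def)
  obtain j where j: "j \<in> J" using mpos J by fastforce
  \<comment> \<open>A zero row is orthogonal to itself, whereas \<open>w j\<close> is rejected for
    \<open>S = {}\<close>. This nonconstant subfunction forces a leaf in the block, as the counting
    bound requires.\<close>
  have "\<phi> {} (\<lambda>_. False)"
    unfolding \<phi>_eq OV_iff using i by (auto simp: override_on_def intro!: exI[of _ i])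
  then have "\<phi> {} (\<lambda>_. False) \<noteq> \<phi> {} (w j)"
    using detect[of "{}" j] j by simp
  then have pos: "leaves_in ?B F \<noteq> 0"
    using subfunctions_leaves_in_0[of ?B F "\<phi> {}"] sub by blast
  have "2 ^ m = card (\<phi> ` Pow J)"
    using card_image[OF inj] J by (simp add: card_Pow)
  also have "\<dots> \<le> card (subfunctions ?B F)"
    using card_subfunctions_le[OF F(1) pos] sub by (intro card_mono) auto
  also have "\<dots> \<le> 2 ^ (5 * leaves_in ?B F - 3)"
    using card_subfunctions_le[OF F(1) pos] by blast
  finally have "m \<le> 5 * leaves_in ?B F - 3"
    by (simp add: power_increasing_iff)
  then show ?thesis by simp
qed

section \<open>The middle binomial coefficient\<close>

text \<open>Squaring keeps the estimate \<open>4 ^ k / sqrt (4 * k + 1)\<close> in the naturals. The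
  induction uses the ratio \<open>2 * (2 * k + 1) / (k + 1)\<close> of consecutive central
  coefficients.\<close>

lemma central_binomial_square: "16 ^ k \<le> (4 * k + 1) * ((2 * k) choose k)\<^sup>2"
proof (induction k)
  case (Suc k)
  let ?c = "(2 * k) choose k" and ?c' = "(2 * Suc k) choose Suc k"
  have rec: "Suc k * ?c' = 2 * (2 * k + 1) * ?c"
  proof -
    have 1: "Suc k * ?c' = (2 * k + 2) * ((2 * k + 1) choose k)"
      using Suc_times_binomial_eq[of "2 * k + 1" k] by (simp add: mult.commute)
    have "(2 * k + 1) choose k = (2 * k + 1) choose Suc k"
      using binomial_symmetric[of k "2 * k + 1"] by simp
    moreover have "Suc k * ((2 * k + 1) choose Suc k) = (2 * k + 1) * ?c"
      using Suc_times_binomial_eq[of "2 * k" k] by (simp add: mult.commute)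
    ultimately show ?thesis using 1 by (simp add: algebra_simps)
  qed
  have sq: "(Suc k)\<^sup>2 * ?c'\<^sup>2 = (2 * (2 * k + 1))\<^sup>2 * ?c\<^sup>2"
    using arg_cong[OF rec, of "\<lambda>x. x\<^sup>2"] by (simp only: power_mult_distrib)
  have "(Suc k)\<^sup>2 * (4 * k + 1) * 16 ^ Suc k \<le> 16 * (Suc k)\<^sup>2 * (4 * k + 1) * ((4 * k + 1) * ?c\<^sup>2)"
    using mult_left_mono[OF Suc.IH, of "16 * (Suc k)\<^sup>2 * (4 * k + 1)"]
    by (simp only: power_Suc mult_ac zero_le)
  \<comment> \<open>Apart from the common factor, the two sides differ by exactly 4.\<close>
  also have "16 * (Suc k)\<^sup>2 * (4 * k + 1) * ((4 * k + 1) * ?c\<^sup>2)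
      \<le> (2 * (2 * k + 1))\<^sup>2 * (4 * k + 5) * ((4 * k + 1) * ?c\<^sup>2)"
    by (rule mult_right_mono) (simp_all add: power2_eq_square algebra_simps)
  also have "\<dots> = (Suc k)\<^sup>2 * (4 * k + 1) * ((4 * k + 5) * ?c'\<^sup>2)"
  proof -
    have "(2 * (2 * k + 1))\<^sup>2 * (4 * k + 5) * ((4 * k + 1) * ?c\<^sup>2)
        = (4 * k + 5) * (4 * k + 1) * ((2 * (2 * k + 1))\<^sup>2 * ?c\<^sup>2)"
      by (simp only: mult_ac)
    also have "\<dots> = (4 * k + 5) * (4 * k + 1) * ((Suc k)\<^sup>2 * ?c'\<^sup>2)"
      by (simp only: sq)
    finally show ?thesis by (simp only: mult_ac)
  qed
  finally have "16 ^ Suc k \<le> (4 * k + 5) * ?c'\<^sup>2"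
    by (subst (asm) mult_le_cancel1) simp
  then show ?case by (simp add: algebra_simps)
qed simp

text \<open>For odd \<open>m\<close> the middle coefficient is half of the next central one, which
  turns \<open>4 * Suc k + 1\<close> into \<open>2 * m + 3\<close>.\<close>

lemma middle_binomial_square: "4 ^ m \<le> (2 * m + 3) * (m choose (m div 2))\<^sup>2"
proof (cases "even m")
  case True
  then obtain k where m: "m = 2 * k" by blast
  have "4 ^ m \<le> (4 * k + 1) * ((2 * k) choose k)\<^sup>2"
    using central_binomial_square[of k] by (simp add: m power_mult)
  also have "\<dots> \<le> (2 * m + 3) * (m choose (m div 2))\<^sup>2"
    using m by (intro mult_mono) auto
  finally show ?thesis .
next
  case False
  then obtain k where m: "m = 2 * k + 1" by (elim oddE)
  have "(2 * k + 1) choose Suc k = (2 * k + 1) choose k"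
    using binomial_symmetric[of k "2 * k + 1"] by simp
  then have "(2 * Suc k) choose Suc k = 2 * (m choose (m div 2))"
    by (simp add: m)
  then have "16 ^ Suc k \<le> (4 * Suc k + 1) * (2 * (m choose (m div 2)))\<^sup>2"
    using central_binomial_square[of "Suc k"] by simp
  also have "\<dots> = 4 * ((2 * m + 3) * (m choose (m div 2))\<^sup>2)"
    by (simp add: m power2_eq_square algebra_simps)
  also have "(16 :: nat) ^ Suc k = 4 * 4 ^ m"
    by (simp add: m power_mult)
  finally show ?thesis by simp
qed

lemma middle_binomial_ge:
  assumes "d \<ge> 1"
  shows "2 ^ d / (4 * sqrt (real d)) \<le> real ((d - 1) choose ((d - 1) div 2))"
proof -
  let ?N = "(d - 1) choose ((d - 1) div 2)"
  have "4 ^ d = (4 :: nat) * 4 ^ (d - 1)"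
    using assms by (cases d) auto
  also have "\<dots> \<le> 4 * ((2 * (d - 1) + 3) * ?N\<^sup>2)"
    using middle_binomial_square[of "d - 1"] by simp
  also have "\<dots> \<le> 16 * d * ?N\<^sup>2"
    using assms by simp
  finally have "real (4 ^ d) \<le> real (16 * d * ?N\<^sup>2)"
    by (simp only: of_nat_le_iff)
  moreover have "((2 :: real) ^ d)\<^sup>2 = 4 ^ d"
    by (simp add: power2_eq_square flip: power_mult_distrib)
  moreover have "(4 * sqrt (real d) * real ?N)\<^sup>2 = 16 * real d * (real ?N)\<^sup>2"
    by (simp add: power_mult_distrib)
  ultimately have "((2 :: real) ^ d)\<^sup>2 \<le> (4 * sqrt (real d) * real ?N)\<^sup>2"
    by simp
  then have "2 ^ d \<le> 4 * sqrt (real d) * real ?N"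
    by (rule power2_le_imp_le) simp
  then show ?thesis using assms by (simp add: divide_le_eq mult.commute)
qed

section \<open>The lower bound\<close>

text \<open>A single leaf accepts the all-ones input, which has no orthogonal pair. The bound
  settles \<open>n = 1\<close> and absorbs the extra 1 in \<open>Suc (wires F)\<close>.\<close>

lemma wires_pos:
  assumes "symmetric_gate_formula F" "computes_OV n d F" "n \<ge> 1" "d \<ge> 1"
  shows "wires F \<ge> 1"
proof (cases F)
  case (Leaf v)
  have "eval_formula (\<lambda>_. True) F" by (simp add: Leaf)
  then have "OV n d (\<lambda>_. True)" using assms(2) by (simp add: computes_OV_def)
  then show ?thesis using assms(4) by (auto simp: OV_iff)
next
  case (Gate g fs)
  then show ?thesis using assms(1) by (cases fs) auto
qed

theorem theorem1p3:
  "\<exists>\<kappa>::real. \<kappa> > 0 \<and>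
     (\<forall>(n::nat) (d::nat) (F :: (nat \<times> nat) formula).
        n \<ge> 1 \<longrightarrow> d \<ge> 2 \<longrightarrow> symmetric_gate_formula F \<longrightarrow> computes_OV n d F \<longrightarrow>
          real (wires F) \<ge>
            \<kappa> * min ((real n)\<^sup>2 / log 2 (real d))
                     (real n * 2 ^ d / (sqrt (real d) * log 2 (real d))))"
\<comment> \<open>The 40 is 10 from \<open>n * m \<le> 10 * wires F\<close> times 4 from
  \<open>min (real n) R \<le> 4 * real m\<close>.\<close>
proof (intro exI[of _ "1 / 40"] conjI allI impI)
  fix n d :: nat and F :: "(nat \<times> nat) formula"
  assume n: "n \<ge> 1" and d: "d \<ge> 2" and F: "symmetric_gate_formula F" "computes_OV n d F"
  define L where "L = log 2 (real d)"
  have L: "L \<ge> 1" using d by (simp add: L_def le_log_iff)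
  define R where "R = 2 ^ d / sqrt (real d)"
  have R: "R \<ge> 0" by (simp add: R_def)
  have W: "wires F \<ge> 1" using wires_pos[OF F] n d by simp
  have "min ((real n)\<^sup>2 / L) (real n * 2 ^ d / (sqrt (real d) * L)) = real n * min (real n) R / L"
  proof -
    have "real n * 2 ^ d / (sqrt (real d) * L) = real n * R / L"
      by (simp add: R_def)
    moreover have "min (real n * real n) (real n * R) = real n * min (real n) R"
      by (simp add: min_mult_distrib_left)
    ultimately show ?thesis
      using L min_divide_distrib_right[of "real n * real n" "real n * R" L]
      by (simp add: power2_eq_square)
  qed
  \<comment> \<open>The logarithm is at least 1 and is simply dropped: the bound obtained is
    stronger by that factor.\<close>
  also have "\<dots> \<le> real n * min (real n) R"
    using L R mult_left_mono[OF L, of "real n * min (real n) R"] by (simp add: divide_le_eq)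
  also have "\<dots> \<le> 40 * real (wires F)"
  proof (cases "n = 1")
    \<comment> \<open>There are no other rows to vary, but the minimum is at most 1.\<close>
    case True
    then show ?thesis using W by (auto simp: min_def)
  next
    case False
    define N where "N = (d - 1) choose ((d - 1) div 2)"
    define m where "m = min (n - 1) N"
    have n2: "n \<ge> 2" using n False by simp
    have "m \<le> 5 * leaves_in ({i} \<times> UNIV) F" if "i < n" for i
      using leaves_in_block_ge[OF F d n2 that] by (simp add: m_def N_def)
    then have "(\<Sum>i<n. m) \<le> (\<Sum>i<n. 5 * leaves_in ({i} \<times> UNIV) F)"
      by (intro sum_mono) auto
    also have "\<dots> = 5 * (\<Sum>i<n. leaves_in ({i} \<times> UNIV) F)"
      by (simp add: sum_distrib_left)
    also have "\<dots> \<le> 5 * Suc (wires F)"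
      by (intro mult_left_mono sum_leaves_in_le) (auto simp: disjoint_family_on_def)
    also have "\<dots> \<le> 10 * wires F" using W by simp
    finally have "real (n * m) \<le> real (10 * wires F)"
      by (simp only: of_nat_le_iff) simp
    moreover have "min (real n) R \<le> 4 * real m"
    proof -
      have "R \<le> 4 * real N"
        using middle_binomial_ge[of d] d by (simp add: R_def N_def field_simps)
      moreover have "real n \<le> 4 * real (n - 1)" using n2 by simp
      ultimately show ?thesis unfolding m_def by (auto simp: min_def)
    qed
    then have "real n * min (real n) R \<le> real n * (4 * real m)"
      by (intro mult_left_mono) auto
    ultimately show ?thesis by simp
  qed
  finally show "1 / 40 * min ((real n)\<^sup>2 / log 2 (real d))
      (real n * 2 ^ d / (sqrt (real d) * log 2 (real d))) \<le> real (wires F)"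
    by (simp add: L_def)
qed simp

end
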